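(* Let $z\in\mathbb{C}\setminus(\mathbb{R}\cup\mathrm{i}\mathbb{R})$, let $\pi$ be a Hermitian projection of $\mathbb{C}^n$, and let $\rho$ be the Hermitian projection of $\mathbb{C}^n$ onto $g_{z,\pi}(-\bar z)(\mathrm{Im}\,\bar\pi)$. Set $$f_{z,\pi}:=g_{-\bar z,\rho}\,g_{z,\pi}.$$ Then $f_{z,\pi}\in\Lambda^{\tau,\sigma}_{-,m}(n)$.
   Context: A Hermitian projection of $\mathbb{C}^n$ is a matrix $\pi$ with $\pi^2=\pi=\pi^*$; $\pi^\perp=\mathrm{I}-\pi$, $\mathrm{Im}\,\pi$ is its image, and $\bar\pi$ its entrywise complex conjugate. For $z\in\mathbb{C}\setminus\mathbb{R}$ and a Hermitian projection $\pi$, $$g_{z,\pi}(\lambda)=\pi+\frac{\lambda-\bar z}{\lambda-z}\,\pi^\perp .$$ $\Lambda^{\tau,\sigma}_{-,m}(n)$ is the group of rational maps $g$ from $\mathbb{C}\cup\{\infty\}$ to $GL(n,\mathbb{C})$ (matrices of rational functions of $\lambda$, not identically singular, regular at $\infty$) with $g(\infty)=\mathrm{I}$ satisfying $g(\bar\lambda)^*g(\lambda)=\mathrm{I}$ and $g(-\lambda)^tg(\lambda)=\mathrm{I}$. *)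

theory Defs
  imports "HOL-Analysis.Analysis" "HOL-Computational_Algebra.Polynomial"
    "HOL-Computational_Algebra.Fraction_Field"
begin

type_synonym ratfun = "complex poly fract"

definition rf_regular :: "ratfun \<Rightarrow> complex \<Rightarrow> bool" where
  "rf_regular r a \<longleftrightarrow> (\<exists>p q. r = Fract p q \<and> poly q a \<noteq> 0)"

text \<open>The value does not depend on the chosen fraction; see \<open>rf_eval_Fract\<close>. It is unspecified
  at a pole.\<close>

definition rf_eval :: "ratfun \<Rightarrow> complex \<Rightarrow> complex" where
  "rf_eval r a = (THE v. \<exists>p q. r = Fract p q \<and> poly q a \<noteq> 0 \<and> v = poly p a / poly q a)"

definition rf_regular_inf :: "ratfun \<Rightarrow> bool" where
  "rf_regular_inf r \<longleftrightarrow> (\<exists>p q. r = Fract p q \<and> q \<noteq> 0 \<and> degree p \<le> degree q)"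

definition rf_eval_inf :: "ratfun \<Rightarrow> complex" where
  "rf_eval_inf r = (THE v. \<exists>p q. r = Fract p q \<and> q \<noteq> 0 \<and> degree p \<le> degree q \<and>
     v = coeff p (degree q) / lead_coeff q)"

lemma rf_eval_Fract:
  assumes "poly q a \<noteq> 0"
  shows "rf_eval (Fract p q) a = poly p a / poly q a"
  unfolding rf_eval_def
proof (rule the_equality)
  show "\<exists>p' q'. Fract p q = Fract p' q' \<and> poly q' a \<noteq> 0 \<and> poly p a / poly q a = poly p' a / poly q' a"
    using assms by blast
next
  fix v
  assume "\<exists>p' q'. Fract p q = Fract p' q' \<and> poly q' a \<noteq> 0 \<and> v = poly p' a / poly q' a"
  then obtain p' q' where *: "Fract p q = Fract p' q'" "poly q' a \<noteq> 0" "v = poly p' a / poly q' a"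
    by blast
  have "q \<noteq> 0" "q' \<noteq> 0" using assms *(2) by auto
  with *(1) have "p * q' = p' * q" by (simp add: eq_fract)
  then have "poly p a * poly q' a = poly p' a * poly q a" by (metis poly_mult)
  then show "v = poly p a / poly q a" using assms *(2,3) by (simp add: frac_eq_eq)
qed

lemma rf_eval_inf_Fract:
  assumes "q \<noteq> 0" "degree p \<le> degree q"
  shows "rf_eval_inf (Fract p q) = coeff p (degree q) / lead_coeff q"
  unfolding rf_eval_inf_def
proof (rule the_equality)
  show "\<exists>p' q'. Fract p q = Fract p' q' \<and> q' \<noteq> 0 \<and> degree p' \<le> degree q' \<and>
      coeff p (degree q) / lead_coeff q = coeff p' (degree q') / lead_coeff q'"
    using assms by blast
next
  fix v
  assume "\<exists>p' q'. Fract p q = Fract p' q' \<and> q' \<noteq> 0 \<and> degree p' \<le> degree q' \<and>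
      v = coeff p' (degree q') / lead_coeff q'"
  then obtain p' q' where *: "Fract p q = Fract p' q'" "q' \<noteq> 0" "degree p' \<le> degree q'"
      "v = coeff p' (degree q') / lead_coeff q'"
    by blast
  have top: "coeff (r * s) (m + k) = coeff r m * coeff s k"
    if "degree r \<le> m" "degree s \<le> k" for r s :: "complex poly" and m k
  proof -
    have "coeff r i * coeff s (m + k - i) = 0" if "i \<le> m + k" "i \<noteq> m" for i
    proof (cases "i < m")
      case True
      then have "degree s < m + k - i" using \<open>degree s \<le> k\<close> by simp
      then show ?thesis by (simp add: coeff_eq_0)
    next
      case False
      then have "degree r < i" using that \<open>degree r \<le> m\<close> by simp
      then show ?thesis by (simp add: coeff_eq_0)
    qed
    then have "(\<Sum>i\<le>m + k. coeff r i * coeff s (m + k - i)) =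
        (\<Sum>i\<in>{m}. coeff r i * coeff s (m + k - i))"
      by (intro sum.mono_neutral_right) auto
    then show ?thesis by (simp add: coeff_mult)
  qed
  from *(1,2) assms have "p * q' = p' * q" by (simp add: eq_fract)
  then have "coeff p (degree q) * lead_coeff q' = coeff p' (degree q') * lead_coeff q"
    using top[of p "degree q" q' "degree q'"] top[of p' "degree q'" q "degree q"] assms *(3)
    by (simp add: add.commute)
  then show "v = coeff p (degree q) / lead_coeff q"
    using assms *(2,4) by (simp add: frac_eq_eq)
qed

type_synonym 'n ratmat = "ratfun ^ 'n ^ 'n"

definition rm_regular :: "'n::finite ratmat \<Rightarrow> complex \<Rightarrow> bool" where
  "rm_regular g a \<longleftrightarrow> (\<forall>i j. rf_regular (g $ i $ j) a)"

definition rm_eval :: "'n::finite ratmat \<Rightarrow> complex \<Rightarrow> complex ^ 'n ^ 'n" where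
  "rm_eval g a = map_matrix (\<lambda>r. rf_eval r a) g"

definition rm_regular_inf :: "'n::finite ratmat \<Rightarrow> bool" where
  "rm_regular_inf g \<longleftrightarrow> (\<forall>i j. rf_regular_inf (g $ i $ j))"

definition rm_eval_inf :: "'n::finite ratmat \<Rightarrow> complex ^ 'n ^ 'n" where
  "rm_eval_inf g = map_matrix rf_eval_inf g"

definition conj_transpose :: "complex ^ 'n::finite ^ 'n \<Rightarrow> complex ^ 'n ^ 'n" where
  "conj_transpose A = transpose (map_matrix cnj A)"

definition hermitian_projection :: "complex ^ 'n::finite ^ 'n \<Rightarrow> bool" where
  "hermitian_projection P \<longleftrightarrow> P ** P = P \<and> conj_transpose P = P"

definition mat_image :: "complex ^ 'n::finite ^ 'n \<Rightarrow> (complex ^ 'n) set" where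
  "mat_image A = range ((*v) A)"

text \<open>Specified only when \<open>W\<close> is a complex linear subspace.\<close>

definition hermitian_projection_onto :: "(complex ^ 'n::finite) set \<Rightarrow> complex ^ 'n ^ 'n" where
  "hermitian_projection_onto W = (THE P. hermitian_projection P \<and> mat_image P = W)"

definition rf_const :: "complex \<Rightarrow> ratfun" where
  "rf_const c = Fract [:c:] 1"

definition g_factor :: "complex \<Rightarrow> complex ^ 'n::finite ^ 'n \<Rightarrow> 'n ratmat" where
  "g_factor z P = (\<chi> i j. rf_const (P $ i $ j)
     + Fract [:- cnj z, 1:] [:- z, 1:] * rf_const ((mat 1 - P) $ i $ j))"

lemma rm_eval_g_factor:
  assumes "a \<noteq> z"
  shows "rm_eval (g_factor z P) a
    = (\<chi> i j. P $ i $ j + (a - cnj z) / (a - z) * (mat 1 - P) $ i $ j)"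
proof -
  have "rf_eval (rf_const c + Fract [:- cnj z, 1:] [:- z, 1:] * rf_const d) a
      = c + (a - cnj z) / (a - z) * d" for c d
    using assms by (simp add: rf_const_def rf_eval_Fract field_simps)
  then show ?thesis
    by (simp add: rm_eval_def g_factor_def map_matrix_def)
qed

definition f_factor :: "complex \<Rightarrow> complex ^ 'n::finite ^ 'n \<Rightarrow> 'n ratmat" where
  "f_factor z P =
     (let \<rho> = hermitian_projection_onto
                ((*v) (rm_eval (g_factor z P) (- cnj z)) ` mat_image (map_matrix cnj P))
      in g_factor (- cnj z) \<rho> ** g_factor z P)"

text \<open>The two reality conditions are identities of rational functions, so they are imposed at the
  points where both factors are regular.\<close>

definition Lambda_tau_sigma :: "'n::finite ratmat set" where
  "Lambda_tau_sigma = {g. det g \<noteq> 0 \<and> rm_regular_inf g \<and> rm_eval_inf g = mat 1 \<and>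
     (\<forall>l. rm_regular g l \<and> rm_regular g (cnj l) \<longrightarrow>
        conj_transpose (rm_eval g (cnj l)) ** rm_eval g l = mat 1) \<and>
     (\<forall>l. rm_regular g l \<and> rm_regular g (- l) \<longrightarrow>
        transpose (rm_eval g (- l)) ** rm_eval g l = mat 1)}"

end

theory Submission
  imports Defs
begin

text \<open>
  Write \<open>Q = mat 1 - \<pi>\<close>, \<open>R = mat 1 - \<rho>\<close> and \<open>c = z - cnj z\<close>. In terms of its pole the first factor is
  \<open>1 + c / (l - z) Q\<close>, and the second is \<open>1 + c / (l + cnj z) R\<close>. Each factor is unitary in the sense of
  the first reality condition, hence so is their product \<open>f\<close>. Given this, the second reality
  condition says that \<open>f\<close> agrees with \<open>f' l = mat_cnj (f (- cnj l))\<close>. Conjugation exchanges the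
  two poles, so
  \<open>f' l = (1 + c / (l - z) mat_cnj R) (1 + c / (l + cnj z) mat_cnj Q)\<close>: the factors of \<open>f\<close> and
  \<open>f'\<close> have their poles in opposite order, and the theorem is a permutability statement for which
  \<open>\<rho>\<close> was chosen.

  Both functions are 1 at infinity and have at most simple poles, at \<open>z\<close> and \<open>- cnj z\<close>, so
  \<open>f - f' = c D / (l - z) - c (mat_cnj D) / (l + cnj z)\<close> for one constant matrix \<open>D\<close>. Three facts
  force \<open>D = 0\<close> (\<open>residues_agree\<close>):
  \<^item> The residues of \<open>f\<close> and \<open>f'\<close> at \<open>z\<close> both kill the image of \<open>\<pi>\<close>, so \<open>D = D Q\<close>. For \<open>f'\<close> this is
    the conjugate of the statement that \<open>\<rho>\<close> fixes \<open>g_factor z \<pi> (- cnj z)\<close> applied to the image of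
    \<open>mat_cnj \<pi>\<close>.
  \<^item> At \<open>l = cnj z\<close> both functions kill the image of \<open>Q\<close>, whence \<open>D Q = - s (mat_cnj D) Q\<close> with
    \<open>s = c / (2 cnj z)\<close>. For \<open>f'\<close> this uses that \<open>\<rho>\<close> projects onto nothing more than that image.
  \<^item> Multiplication by the Hermitian projection \<open>Q\<close> does not increase the Frobenius norm, and
    \<open>cmod s = \<bar>Im z\<bar> / cmod z < 1\<close> because \<open>z\<close> is not imaginary. So \<open>norm D \<le> cmod s * norm D\<close>.

  The resulting identities hold away from the points \<open>\<plusminus>z\<close> and \<open>\<plusminus>cnj z\<close>. The
  product may be regular at such a point although a factor is not, and there the reality conditions
  follow by continuity (\<open>matrix_identity_extends\<close>).
\<close>

section \<open>Matrix algebra with complex scalars\<close>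

text \<open>On a matrix \<open>*s\<close> takes a vector as its scalar and \<open>scaleR\<close> a real number, whereas the
  residues below carry complex scalars.\<close>

definition mscale :: "complex \<Rightarrow> complex ^ 'n::finite ^ 'n \<Rightarrow> complex ^ 'n ^ 'n" (infixr \<open>*\<^sub>m\<close> 75) where
  "c *\<^sub>m A = (\<chi> i j. c * A $ i $ j)"

lemma mscale_nth [simp]: "(c *\<^sub>m A) $ i $ j = c * A $ i $ j"
  by (simp add: mscale_def)

lemma matrix_eq_iff: "A = B \<longleftrightarrow> (\<forall>i j. A $ i $ j = B $ i $ j)"
  by (auto simp: vec_eq_iff)

lemma mscale_mult_left: "(c *\<^sub>m A) ** B = c *\<^sub>m (A ** B)"
  by (simp add: matrix_eq_iff matrix_matrix_mult_def sum_distrib_left mult_ac)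

lemma mscale_mult_right: "A ** (c *\<^sub>m B) = c *\<^sub>m (A ** B)"
  by (simp add: matrix_eq_iff matrix_matrix_mult_def sum_distrib_left mult_ac)

lemma matrix_diff_ldistrib: "A ** (B - C) = A ** B - A ** C" for A :: "'a::ring_1 ^ 'n ^ 'm"
  by (simp add: matrix_eq_iff matrix_matrix_mult_def sum_subtractf algebra_simps)

lemma matrix_diff_rdistrib: "(B - C) ** A = B ** A - C ** A" for B :: "'a::ring_1 ^ 'n ^ 'm"
  by (simp add: matrix_eq_iff matrix_matrix_mult_def sum_subtractf algebra_simps)

lemma matrix_add_rdistrib: "(B + C) ** A = B ** A + C ** A" for B :: "'a::semiring_1 ^ 'n ^ 'm"
  by (simp add: matrix_eq_iff matrix_matrix_mult_def sum.distrib algebra_simps)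

lemma matrix_zero_mult [simp]: "0 ** A = 0" "A ** 0 = 0" for A :: "'a::semiring_1 ^ 'n ^ 'n"
  by (simp_all add: matrix_eq_iff matrix_matrix_mult_def)

lemma mscale_zero [simp]: "c *\<^sub>m 0 = 0"
  by (simp add: matrix_eq_iff)

lemmas matrix_expand = matrix_add_ldistrib matrix_add_rdistrib matrix_diff_ldistrib
  matrix_diff_rdistrib mscale_mult_left mscale_mult_right matrix_mul_assoc

abbreviation mat_cnj :: "complex ^ 'n::finite ^ 'n \<Rightarrow> complex ^ 'n ^ 'n" where
  "mat_cnj \<equiv> map_matrix cnj"

lemma mat_cnj_simps [simp]:
  "mat_cnj (A + B) = mat_cnj A + mat_cnj B"
  "mat_cnj (A - B) = mat_cnj A - mat_cnj B"
  "mat_cnj (A ** B) = mat_cnj A ** mat_cnj B"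
  "mat_cnj (c *\<^sub>m A) = cnj c *\<^sub>m mat_cnj A"
  "mat_cnj (mat 1) = mat 1"
  "mat_cnj 0 = 0"
  "mat_cnj (mat_cnj A) = A"
  by (simp_all add: matrix_eq_iff matrix_matrix_mult_def mat_def)

lemma conj_transpose_simps [simp]:
  "conj_transpose (A + B) = conj_transpose A + conj_transpose B"
  "conj_transpose (A - B) = conj_transpose A - conj_transpose B"
  "conj_transpose (A ** B) = conj_transpose B ** conj_transpose A"
  "conj_transpose (c *\<^sub>m A) = cnj c *\<^sub>m conj_transpose A"
  "conj_transpose (mat 1) = mat 1"
  "conj_transpose 0 = 0"
  "conj_transpose (conj_transpose A) = A"
  "conj_transpose (mat_cnj A) = transpose A"
  by (auto simp: conj_transpose_def matrix_eq_iff matrix_matrix_mult_def mat_def transpose_def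
      mult_ac)

lemma conj_transpose_mat_cnj: "conj_transpose (mat_cnj A) = mat_cnj (conj_transpose A)"
  by (simp add: conj_transpose_def matrix_eq_iff transpose_def)

text \<open>\<open>inner\<close> is the real part of the Hermitian form. This suffices throughout, since a vector that
  is real-orthogonal to a complex subspace is also complex-orthogonal to it.\<close>

lemma inner_conj_transpose:
  fixes A :: "complex ^ 'n::finite ^ 'n"
  shows "inner (A *v x) y = inner x (conj_transpose A *v y)"
proof -
  have "inner (A *v x) y = (\<Sum>i\<in>UNIV. \<Sum>j\<in>UNIV. inner (A $ i $ j * x $ j) (y $ i))"
    by (simp add: inner_vec_def matrix_vector_mult_def inner_sum_left)
  also have "\<dots> = (\<Sum>i\<in>UNIV. \<Sum>j\<in>UNIV. inner (x $ j) (cnj (A $ i $ j) * y $ i))"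
    by (simp add: inner_complex_def algebra_simps)
  also have "\<dots> = (\<Sum>j\<in>UNIV. \<Sum>i\<in>UNIV. inner (x $ j) (cnj (A $ i $ j) * y $ i))"
    by (rule sum.swap)
  also have "\<dots> = inner x (conj_transpose A *v y)"
    by (simp add: inner_vec_def matrix_vector_mult_def inner_sum_right conj_transpose_def
        transpose_def)
  finally show ?thesis .
qed

section \<open>Hermitian projections\<close>

lemma hermitian_projection_absorb:
  assumes "hermitian_projection P" "mat_image B \<subseteq> mat_image P"
  shows "P ** B = B"
proof -
  have "P *v (B *v x) = B *v x" for x
  proof -
    have "B *v x \<in> mat_image P"
      using assms(2) unfolding mat_image_def by blast
    then obtain y where "B *v x = P *v y"
      unfolding mat_image_def by blast
    then show ?thesis
      using assms(1) by (simp add: matrix_vector_mul_assoc hermitian_projection_def)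
  qed
  then show ?thesis
    by (simp add: matrix_eq matrix_vector_mul_assoc[symmetric])
qed

lemma hermitian_projection_compl:
  assumes "hermitian_projection P"
  shows "hermitian_projection (mat 1 - P)"
  using assms by (simp add: hermitian_projection_def matrix_diff_ldistrib matrix_diff_rdistrib)

lemma hermitian_projection_mat_cnj:
  assumes "hermitian_projection P"
  shows "hermitian_projection (mat_cnj P)"
  using assms
  by (metis conj_transpose_mat_cnj hermitian_projection_def mat_cnj_simps(3))

lemma hermitian_projection_norm_le:
  assumes "hermitian_projection P"
  shows "norm (P *v x) \<le> norm x"
proof -
  have "norm (P *v x) ^ 2 = inner x (P *v x)"
    using assms
    by (simp add: power2_norm_eq_inner inner_conj_transpose hermitian_projection_def
        matrix_vector_mul_assoc)
  also have "\<dots> \<le> norm x * norm (P *v x)"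
    by (rule norm_cauchy_schwarz)
  finally show ?thesis
    by (cases "P *v x = 0") (auto simp: power2_eq_square)
qed

text \<open>Each row of \<open>A ** P\<close> is the image of the corresponding row of \<open>A\<close> under \<open>transpose P\<close>, which for
  a Hermitian \<open>P\<close> is the projection \<open>mat_cnj P\<close>.\<close>

lemma norm_mult_hermitian_projection_le:
  assumes "hermitian_projection P"
  shows "norm (A ** P) \<le> norm A"
proof (rule norm_le_componentwise_cart)
  fix i
  have "P = mat_cnj (transpose P)"
    using assms by (simp add: hermitian_projection_def conj_transpose_def matrix_eq_iff transpose_def)
  then have "transpose P = mat_cnj P"
    by (metis mat_cnj_simps(7))
  moreover have "(A ** P) $ i = transpose P *v (A $ i)"
    by (simp add: vec_eq_iff matrix_matrix_mult_def vector_matrix_mult_def mult.commute)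
  ultimately show "norm ((A ** P) $ i) \<le> norm (A $ i)"
    using hermitian_projection_norm_le[OF hermitian_projection_mat_cnj[OF assms]] by metis
qed

lemma norm_mscale: "norm (c *\<^sub>m A) = cmod c * norm A"
  by (simp add: norm_vec_def norm_mult L2_set_right_distrib)

lemma norm_mat_cnj: "norm (mat_cnj A) = norm A"
  by (simp add: norm_vec_def)

lemma hermitian_projection_unique:
  assumes "hermitian_projection P" "hermitian_projection P'" "mat_image P = mat_image P'"
  shows "P = P'"
proof -
  have "P ** P' = P'" "P' ** P = P"
    using assms by (simp_all add: hermitian_projection_absorb)
  then show ?thesis
    using assms(1,2) by (metis conj_transpose_simps(3) hermitian_projection_def)
qed

text \<open>A complex subspace is a real subspace, so every vector has a real-orthogonal decomposition. The
  matrix with columns \<open>p (axis j 1)\<close>, for \<open>p x\<close> a chosen component of \<open>x\<close> in \<open>W\<close>, is the projection: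
  by linearity \<open>P\<close> maps every \<open>x\<close> into \<open>W\<close> with \<open>x - P x\<close> orthogonal to \<open>W\<close>, which gives
  \<open>conj_transpose P ** (mat 1 - P) = 0\<close>.\<close>

lemma hermitian_projection_exists:
  fixes W :: "(complex ^ 'n::finite) set"
  assumes W: "vec.subspace W"
  shows "\<exists>P. hermitian_projection P \<and> mat_image P = W"
proof -
  have scaleR: "r *\<^sub>R x = complex_of_real r *s x" for r and x :: "complex ^ 'n"
    by (simp add: vec_eq_iff complex_eq_iff)
  have "subspace W"
    using W unfolding subspace_def vec.subspace_def by (simp add: scaleR)
  then have span: "span W = W"
    by (simp add: span_eq_iff)
  have "\<exists>y. y \<in> W \<and> (\<forall>w\<in>W. inner (x - y) w = 0)" for x :: "complex ^ 'n"
    using orthogonal_subspace_decomp_exists[of W x] span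
    by (metis add_diff_cancel_left' orthogonal_def)
  then obtain p where p: "\<And>x. p x \<in> W" "\<And>x w. w \<in> W \<Longrightarrow> inner (x - p x) w = 0"
    by metis
  define P :: "complex ^ 'n ^ 'n" where "P = (\<chi> i j. p (axis j 1) $ i)"
  have P: "P *v x = (\<Sum>j\<in>UNIV. x $ j *s p (axis j 1))" for x
    by (simp add: vec_eq_iff P_def matrix_vector_mult_def mult.commute)
  have P_in: "P *v x \<in> W" for x
    unfolding P by (intro vec.subspace_sum vec.subspace_scale W p)
  have cscale: "inner (c *s x) y = inner x (cnj c *s y)" for c and x y :: "complex ^ 'n"
    by (simp add: inner_vec_def inner_complex_def algebra_simps)
  have P_orth: "inner (x - P *v x) w = 0" if "w \<in> W" for x w
  proof -
    have "x - P *v x = (\<Sum>j\<in>UNIV. x $ j *s (axis j 1 - p (axis j 1)))"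
      by (subst basis_expansion[of x, symmetric])
        (simp add: P sum_subtractf vec.scale_right_diff_distrib del: vector_ssub_ldistrib)
    then show ?thesis
      using p(2)[OF vec.subspace_scale[OF W that]]
      by (simp add: inner_sum_left cscale del: vector_ssub_ldistrib)
  qed
  have "conj_transpose P ** (mat 1 - P) = 0"
  proof -
    have "(conj_transpose P ** (mat 1 - P)) *v x = 0" for x
    proof -
      let ?v = "(conj_transpose P ** (mat 1 - P)) *v x"
      have "inner ?v ?v = inner (x - P *v x) (P *v ?v)"
        using inner_conj_transpose[of "conj_transpose P" "x - P *v x" ?v]
        by (simp add: matrix_vector_mul_assoc[symmetric] matrix_vector_mult_diff_rdistrib)
      then show ?thesis
        using P_orth[OF P_in] by (metis inner_eq_zero_iff)
    qed
    then show ?thesis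
      by (simp add: matrix_eq)
  qed
  then have *: "conj_transpose P = conj_transpose P ** P"
    by (simp add: matrix_diff_ldistrib)
  then have adj: "conj_transpose P = P"
    by (metis conj_transpose_simps(3,7))
  with * have "hermitian_projection P"
    unfolding hermitian_projection_def by simp
  moreover have "P *v w = w" if "w \<in> W" for w
  proof -
    have "w - P *v w \<in> W"
      using W that P_in by (intro vec.subspace_diff)
    then show ?thesis
      using P_orth[of "w - P *v w" w] by simp
  qed
  then have "mat_image P = W"
    using P_in by (auto simp: mat_image_def) (metis rangeI)
  ultimately show ?thesis
    by blast
qed

lemma hermitian_projection_onto_range:
  fixes A :: "complex ^ 'n::finite ^ 'n"
  shows "hermitian_projection (hermitian_projection_onto (mat_image A))"
    and "mat_image (hermitian_projection_onto (mat_image A)) = mat_image A"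
proof -
  have "vec.subspace (mat_image A)"
    unfolding mat_image_def
    by (intro vec.subspace_image vec.subspace_UNIV)
  then obtain P where P: "hermitian_projection P \<and> mat_image P = mat_image A"
    using hermitian_projection_exists by blast
  then have "hermitian_projection_onto (mat_image A) = P"
    unfolding hermitian_projection_onto_def
    by (rule the_equality) (use P hermitian_projection_unique in auto)
  with P show "hermitian_projection (hermitian_projection_onto (mat_image A))"
    "mat_image (hermitian_projection_onto (mat_image A)) = mat_image A"
    by auto
qed

section \<open>The residues of the two factorizations\<close>

text \<open>The two sides are, up to the factor \<open>z - cnj z\<close>, the residues at \<open>z\<close> of \<open>f\<close> and of its conjugate
  \<open>f'\<close>; the matrix \<open>mat 1 - k *\<^sub>m Q\<close> is the value of \<open>g_factor z P\<close> at \<open>- cnj z\<close>. Their difference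
  \<open>D\<close> satisfies \<open>D = - s *\<^sub>m (mat_cnj D ** Q)\<close> with \<open>cmod s < 1\<close>, so its norm is 0.\<close>

lemma residues_agree:
  fixes P \<rho> :: "complex ^ 'n::finite ^ 'n"
  assumes P: "hermitian_projection P" and \<rho>: "hermitian_projection \<rho>"
    and z: "Re z \<noteq> 0"
    and k_def: "k = (z - cnj z) / (z + cnj z)"
    and Q_def: "Q = mat 1 - P" and R_def: "R = mat 1 - \<rho>"
    and image: "mat_image \<rho> = mat_image ((mat 1 - k *\<^sub>m Q) ** mat_cnj P)"
  shows "Q + k *\<^sub>m (R ** Q) = mat_cnj R + k *\<^sub>m (mat_cnj R ** mat_cnj Q)"
proof -
  define s where "s = (z - cnj z) / (2 * cnj z)"
  have nz: "z + cnj z \<noteq> 0" "cnj z \<noteq> 0" "z \<noteq> 0"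
    using z by (auto simp: complex_eq_iff)
  have "1 - k = 2 * cnj z / (z + cnj z)"
    using nz by (simp add: k_def field_simps)
  then have "s * (1 - k) = k"
    using nz by (simp add: k_def s_def)
  then have ks: "k + s * k = s"
    by (simp add: algebra_simps)
  have cnj_k: "cnj k = - k"
    using nz by (simp add: k_def field_simps)
  have s_lt_1: "cmod s < 1"
  proof -
    have "cmod (z - cnj z) = 2 * \<bar>Im z\<bar>"
      by (simp add: complex_diff_cnj norm_mult)
    moreover have "\<bar>Im z\<bar> < cmod z"
      using z unfolding cmod_def by (intro real_less_rsqrt) simp
    ultimately show ?thesis
      using nz by (simp add: s_def norm_divide norm_mult divide_simps)
  qed

  have QQ: "Q ** Q = Q" "conj_transpose Q = Q"
    using hermitian_projection_compl[OF P] by (auto simp: hermitian_projection_def Q_def)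
  have QP: "Q ** P = 0" "P ** Q = 0"
    using P by (auto simp: hermitian_projection_def Q_def matrix_expand)
  have \<rho>\<rho>: "conj_transpose \<rho> = \<rho>"
    using \<rho> by (auto simp: hermitian_projection_def)

  define M where "M = mat 1 - k *\<^sub>m Q"
  \<comment> \<open>The residue of \<open>f'\<close> at \<open>z\<close> kills the image of \<open>P\<close>.\<close>
  have "R ** M ** mat_cnj P = 0"
    using hermitian_projection_absorb[OF \<rho>, of "M ** mat_cnj P"] image
    by (simp add: M_def[symmetric] R_def matrix_expand)
  then have "mat_cnj (R ** M ** mat_cnj P) = 0"
    by simp
  then have C1: "(mat_cnj R + k *\<^sub>m (mat_cnj R ** mat_cnj Q)) ** P = 0"
    by (simp add: M_def cnj_k matrix_expand) (simp add: matrix_eq_iff)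

  \<comment> \<open>The value of \<open>f'\<close> at \<open>cnj z\<close> kills the image of \<open>Q\<close>. The proof treats the adjoint of the
    conjugate, because membership in the image of \<open>\<rho>\<close> concerns what stands to the right of a matrix.\<close>
  have C2: "mat_cnj \<rho> ** (mat 1 + s *\<^sub>m mat_cnj Q) ** Q = 0"
  proof -
    have "mat_cnj Q ** (mat 1 + s *\<^sub>m Q) ** \<rho> *v x = 0" for x
    proof -
      have "\<rho> *v x \<in> mat_image (M ** mat_cnj P)"
        using image unfolding mat_image_def M_def by blast
      then obtain y where y: "\<rho> *v x = M ** mat_cnj P *v y"
        unfolding mat_image_def by blast
      \<comment> \<open>\<open>mat 1 + s *\<^sub>m Q\<close> is the inverse of \<open>M\<close>, since \<open>s = k / (1 - k)\<close>.\<close>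
      have "s * x = k * (x + s * x)" for x
        by (subst ks[symmetric]) (simp add: algebra_simps)
      then have "(mat 1 + s *\<^sub>m Q) ** M = mat 1"
        by (simp add: M_def matrix_expand QQ) (simp add: matrix_eq_iff)
      moreover have "mat_cnj Q ** mat_cnj P = 0"
        using QP by (metis mat_cnj_simps(3,6))
      ultimately have "mat_cnj Q ** (mat 1 + s *\<^sub>m Q) ** (M ** mat_cnj P) = 0"
        by (metis matrix_mul_assoc matrix_mul_lid)
      then show ?thesis
        by (metis y matrix_vector_mul_assoc matrix_vector_mult_0)
    qed
    then have "mat_cnj Q ** (mat 1 + s *\<^sub>m Q) ** \<rho> = 0"
      by (simp add: matrix_eq)
    then have "mat_cnj (conj_transpose (mat_cnj Q ** (mat 1 + s *\<^sub>m Q) ** \<rho>)) = 0"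
      by simp
    then show ?thesis
      by (simp add: conj_transpose_mat_cnj QQ \<rho>\<rho> matrix_mul_assoc del: conj_transpose_simps(8))
  qed

  define D where "D = Q + k *\<^sub>m (R ** Q) - (mat_cnj R + k *\<^sub>m (mat_cnj R ** mat_cnj Q))"
  have "R ** Q ** P = 0"
    by (metis QP(1) matrix_mul_assoc matrix_zero_mult(2))
  then have "D ** P = 0"
    using C1 QP unfolding D_def
    by (simp only: matrix_diff_rdistrib) (simp add: matrix_add_rdistrib mscale_mult_left)
  then have DQ: "D ** Q = D"
    by (simp add: Q_def matrix_expand)
  have \<rho>_R: "mat_cnj \<rho> = mat 1 - mat_cnj R"
    by (simp add: R_def)
  have XQQ: "X ** Q ** Q = X ** Q" for X
    by (metis QQ(1) matrix_mul_assoc)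
  have "k * r + (s * (u - k * t - (r - k * r)) - k * t) = s * (u - t)" for r t u
    using arg_cong[OF ks, of "\<lambda>c. c * (r - t)"] by (simp add: algebra_simps)
  \<comment> \<open>Up to sign this is the value of \<open>(f - f') Q\<close> at \<open>cnj z\<close>, where \<open>f Q\<close> vanishes.\<close>
  then have "D ** Q + s *\<^sub>m (mat_cnj D ** Q) = mat_cnj \<rho> ** (mat 1 + s *\<^sub>m mat_cnj Q) ** Q"
    by (simp add: D_def \<rho>_R cnj_k matrix_expand QQ XQQ del: mat_cnj_simps(7))
      (simp add: matrix_eq_iff XQQ)
  then have "D ** Q = - (s *\<^sub>m (mat_cnj D ** Q))"
    using C2 by (metis eq_neg_iff_add_eq_0)
  then have "norm D = cmod s * norm (mat_cnj D ** Q)"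
    by (metis DQ norm_minus_cancel norm_mscale)
  also have "\<dots> \<le> cmod s * norm D"
    using norm_mult_hermitian_projection_le[OF hermitian_projection_compl[OF P], of "mat_cnj D"]
    by (intro mult_left_mono) (auto simp: norm_mat_cnj Q_def)
  finally have "D = 0"
    using s_lt_1 by (smt (verit) mult_less_cancel_right1 norm_eq_zero norm_ge_zero mult_le_cancel_right1)
  then show ?thesis
    by (simp add: D_def)
qed

section \<open>Evaluation of rational functions\<close>

lemma rf_const_0: "rf_const 0 = 0" and rf_const_1: "rf_const 1 = 1"
  and rf_const_neg_1: "rf_const (- 1) = - 1"
  by (simp_all add: rf_const_def Zero_fract_def One_fract_def one_pCons)

text \<open>A place of the field of rational functions, seen as a ring homomorphism to the complex numbers
  on the functions regular there. Finite points and infinity are the two instances, so that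
  evaluation of matrix products is treated once for both.\<close>

locale ratfun_place =
  fixes reg :: "ratfun \<Rightarrow> bool" and ev :: "ratfun \<Rightarrow> complex"
  assumes reg_const: "reg (rf_const c)" and ev_const: "ev (rf_const c) = c"
    and reg_add: "reg r \<Longrightarrow> reg s \<Longrightarrow> reg (r + s)"
    and ev_add: "reg r \<Longrightarrow> reg s \<Longrightarrow> ev (r + s) = ev r + ev s"
    and reg_mult: "reg r \<Longrightarrow> reg s \<Longrightarrow> reg (r * s)"
    and ev_mult: "reg r \<Longrightarrow> reg s \<Longrightarrow> ev (r * s) = ev r * ev s"
begin

lemma reg_0: "reg 0" and ev_0: "ev 0 = 0" and reg_1: "reg 1" and ev_1: "ev 1 = 1"
  and reg_neg_1: "reg (- 1)" and ev_neg_1: "ev (- 1) = - 1"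
  using reg_const ev_const rf_const_0 rf_const_1 rf_const_neg_1 by metis+

lemma reg_ev_sum:
  assumes "\<And>x. x \<in> A \<Longrightarrow> reg (f x)"
  shows "reg (sum f A) \<and> ev (sum f A) = (\<Sum>x\<in>A. ev (f x))"
  using assms
  by (induction A rule: infinite_finite_induct) (auto simp: reg_0 ev_0 reg_add ev_add)

lemma reg_ev_prod:
  assumes "\<And>x. x \<in> A \<Longrightarrow> reg (f x)"
  shows "reg (prod f A) \<and> ev (prod f A) = (\<Prod>x\<in>A. ev (f x))"
  using assms
  by (induction A rule: infinite_finite_induct) (auto simp: reg_1 ev_1 reg_mult ev_mult)

lemma reg_matrix_mult:
  assumes "\<And>i j. reg (g $ i $ j)" "\<And>i j. reg (h $ i $ j)"
  shows "reg ((g ** h) $ i $ j)"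
  using assms by (simp add: matrix_matrix_mult_def reg_ev_sum reg_mult)

lemma ev_matrix_mult:
  assumes "\<And>i j. reg (g $ i $ j)" "\<And>i j. reg (h $ i $ j)"
  shows "map_matrix ev (g ** h) = map_matrix ev g ** map_matrix ev h"
  using assms
  by (simp add: vec_eq_iff matrix_matrix_mult_def reg_ev_sum reg_mult ev_mult)

text \<open>In particular, a matrix with nonsingular value at some regular point is not identically singular.\<close>

lemma ev_det:
  fixes g :: "'n::finite ratmat"
  assumes "\<And>i j. reg (g $ i $ j)"
  shows "ev (det g) = det (map_matrix ev g)"
proof -
  have sign: "reg (of_int (sign p)) \<and> ev (of_int (sign p)) = of_int (sign p)" for p :: "'n \<Rightarrow> 'n"
    by (cases p rule: sign_cases) (simp_all add: reg_1 ev_1 reg_neg_1 ev_neg_1)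
  show ?thesis
    unfolding det_def using assms sign
    by (simp add: reg_ev_sum reg_ev_prod reg_mult ev_mult)
qed

end

interpretation finite_place: ratfun_place "\<lambda>r. rf_regular r a" "\<lambda>r. rf_eval r a" for a
proof
  fix c show "rf_regular (rf_const c) a" "rf_eval (rf_const c) a = c"
    unfolding rf_regular_def rf_const_def by (rule exI[of _ "[:c:]"], rule exI[of _ 1])
      (simp_all add: rf_eval_Fract)
next
  fix r s assume "rf_regular r a" "rf_regular s a"
  then obtain p q p' q' where r: "r = Fract p q" "poly q a \<noteq> 0"
    and s: "s = Fract p' q'" "poly q' a \<noteq> 0"
    unfolding rf_regular_def by blast
  then have nz: "q \<noteq> 0" "q' \<noteq> 0" "poly (q * q') a \<noteq> 0"
    by auto
  have sum: "r + s = Fract (p * q' + p' * q) (q * q')" and prod: "r * s = Fract (p * p') (q * q')"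
    using r s nz by simp_all
  show "rf_regular (r + s) a" "rf_regular (r * s) a"
    unfolding rf_regular_def using sum prod nz by blast+
  show "rf_eval (r + s) a = rf_eval r a + rf_eval s a" "rf_eval (r * s) a = rf_eval r a * rf_eval s a"
    unfolding sum prod rf_eval_Fract[OF nz(3)] unfolding r(1) s(1)
    using r(2) s(2) by (simp_all add: rf_eval_Fract field_simps)
qed

text \<open>A version of the leading coefficient of a product in which \<open>m\<close> and \<open>n\<close> only bound the degrees: a
  numerator may have smaller degree than its denominator, and then contributes 0.\<close>

lemma coeff_mult_top:
  fixes p q :: "'a::comm_semiring_0 poly"
  assumes "degree p \<le> m" "degree q \<le> n"
  shows "coeff (p * q) (m + n) = coeff p m * coeff q n"
proof -
  have "coeff p i * coeff q (m + n - i) = 0" if "i \<noteq> m" for i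
    using that assms by (cases "i < m") (simp_all add: coeff_eq_0)
  then have "(\<Sum>i\<le>m + n. coeff p i * coeff q (m + n - i)) =
      (\<Sum>i\<in>{m}. coeff p i * coeff q (m + n - i))"
    by (intro sum.mono_neutral_right) auto
  then show ?thesis
    by (simp add: coeff_mult)
qed

interpretation infinite_place: ratfun_place rf_regular_inf rf_eval_inf
proof
  fix c show "rf_regular_inf (rf_const c)" "rf_eval_inf (rf_const c) = c"
    unfolding rf_regular_inf_def rf_const_def by (rule exI[of _ "[:c:]"], rule exI[of _ 1])
      (simp_all add: rf_eval_inf_Fract)
next
  fix r s assume "rf_regular_inf r" "rf_regular_inf s"
  then obtain p q p' q' where r: "r = Fract p q" "q \<noteq> 0" "degree p \<le> degree q"
    and s: "s = Fract p' q'" "q' \<noteq> 0" "degree p' \<le> degree q'"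
    unfolding rf_regular_inf_def by blast
  have sum: "r + s = Fract (p * q' + p' * q) (q * q')" and prod: "r * s = Fract (p * p') (q * q')"
    using r s by simp_all
  have nz: "q * q' \<noteq> 0" and deg: "degree (q * q') = degree q + degree q'"
    using r s by (simp_all add: degree_mult_eq)
  have dp: "degree (p * p') \<le> degree (q * q')"
    using degree_mult_le[of p p'] r s deg by linarith
  have "degree (p * q') \<le> degree (q * q')" "degree (p' * q) \<le> degree (q * q')"
    using degree_mult_le[of p q'] degree_mult_le[of p' q] r s deg by linarith+
  then have ds: "degree (p * q' + p' * q) \<le> degree (q * q')"
    by (rule degree_add_le)
  show "rf_regular_inf (r + s)" "rf_regular_inf (r * s)"
    unfolding rf_regular_inf_def using sum prod nz ds dp by blast+
  have lead: "coeff (q * q') (degree q + degree q') = lead_coeff q * lead_coeff q'"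
    "coeff (p * p') (degree q + degree q') = coeff p (degree q) * coeff p' (degree q')"
    "coeff (p * q') (degree q + degree q') = coeff p (degree q) * lead_coeff q'"
    "coeff (p' * q) (degree q + degree q') = coeff p' (degree q') * lead_coeff q"
    using coeff_mult_top[of p "degree q" p' "degree q'"] coeff_mult_top[of p "degree q" q' "degree q'"]
      coeff_mult_top[of p' "degree q'" q "degree q"] coeff_mult_top[of q "degree q" q' "degree q'"] r s
    by (simp_all add: add.commute)
  have nzl: "lead_coeff q \<noteq> 0" "lead_coeff q' \<noteq> 0"
    using r s by auto
  show "rf_eval_inf (r * s) = rf_eval_inf r * rf_eval_inf s"
    unfolding prod rf_eval_inf_Fract[OF nz dp] unfolding deg lead
    by (simp add: r s rf_eval_inf_Fract)
  show "rf_eval_inf (r + s) = rf_eval_inf r + rf_eval_inf s"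
    unfolding sum rf_eval_inf_Fract[OF nz ds] unfolding deg lead coeff_add
    using nzl by (simp add: r s rf_eval_inf_Fract field_simps)
qed

section \<open>Extending identities across removable singularities\<close>

lemma isCont_rf_eval:
  assumes "rf_regular r a"
  shows "isCont (rf_eval r) a"
proof -
  obtain p q where r: "r = Fract p q" "poly q a \<noteq> 0"
    using assms unfolding rf_regular_def by blast
  have "open {l. poly q l \<noteq> 0}"
    by (intro open_Collect_neq continuous_intros)
  then have "eventually (\<lambda>l. poly q l \<noteq> 0) (nhds a)"
    using eventually_nhds_in_open[of "{l. poly q l \<noteq> 0}" a] r(2)
    by simp
  then have "eventually (\<lambda>l. rf_eval r l = poly p l / poly q l) (nhds a)"
    by eventually_elim (simp add: r rf_eval_Fract)
  moreover have "isCont (\<lambda>l. poly p l / poly q l) a"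
    using r(2) by simp
  ultimately show ?thesis
    using isCont_cong[of "rf_eval r" "\<lambda>l. poly p l / poly q l" a] by simp
qed

lemma isCont_rm_eval:
  assumes "rm_regular g a"
  shows "isCont (\<lambda>l. rm_eval g l $ i $ j) a"
  using assms isCont_rf_eval unfolding rm_regular_def rm_eval_def by simp

lemma matrix_identity_extends:
  fixes F G :: "complex \<Rightarrow> complex ^ 'n::finite ^ 'n"
  assumes "\<And>i j. isCont (\<lambda>l. F l $ i $ j) a" "\<And>i j. isCont (\<lambda>l. G l $ i $ j) a"
    and S: "finite S" "\<And>l. l \<notin> S \<Longrightarrow> F l ** G l = C"
  shows "F a ** G a = C"
proof -
  have "(F a ** G a) $ i $ j = C $ i $ j" for i j
  proof -
    let ?H = "\<lambda>l. (F l ** G l) $ i $ j"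
    have "isCont ?H a"
      using assms(1,2) by (simp add: matrix_matrix_mult_def)
    moreover have "eventually (\<lambda>l. ?H l = C $ i $ j) (at a)"
      unfolding eventually_at_topological
      using S finite_imp_closed[of "S - {a}"]
      by (intro exI[of _ "- (S - {a})"]) (auto simp del: Compl_Diff_eq)
    then have "(?H \<longlongrightarrow> C $ i $ j) (at a)"
      by (rule tendsto_eventually)
    ultimately show ?thesis
      using tendsto_unique[OF at_neq_bot] unfolding isCont_def by blast
  qed
  then show ?thesis
    by (simp add: vec_eq_iff)
qed

section \<open>The simple factors\<close>

lemma rm_regular_g_factor:
  assumes "l \<noteq> z"
  shows "rm_regular (g_factor z P) l"
proof -
  have "rf_regular (Fract [:- cnj z, 1:] [:- z, 1:]) l"
    unfolding rf_regular_def using assms by (intro exI conjI) auto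
  then show ?thesis
    unfolding rm_regular_def g_factor_def
    by (simp add: finite_place.reg_add finite_place.reg_mult finite_place.reg_const)
qed

lemma rm_eval_g_factor_residue:
  assumes "l \<noteq> z"
  shows "rm_eval (g_factor z P) l = mat 1 + ((z - cnj z) / (l - z)) *\<^sub>m (mat 1 - P)"
proof -
  have "(l - cnj z) / (l - z) = 1 + (z - cnj z) / (l - z)"
    using assms by (simp add: field_simps)
  then show ?thesis
    using assms by (simp add: rm_eval_g_factor matrix_eq_iff algebra_simps)
qed

lemma g_factor_infinity:
  shows "rf_regular_inf (g_factor z P $ i $ j)" "rm_eval_inf (g_factor z P) = mat 1"
proof -
  have b: "rf_regular_inf (Fract [:- cnj z, 1:] [:- z, 1:])"
    "rf_eval_inf (Fract [:- cnj z, 1:] [:- z, 1:]) = 1"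
    unfolding rf_regular_inf_def
    by (rule exI[of _ "[:- cnj z, 1:]"], rule exI[of _ "[:- z, 1:]"]) (simp_all add: rf_eval_inf_Fract)
  then show "rf_regular_inf (g_factor z P $ i $ j)" "rm_eval_inf (g_factor z P) = mat 1"
    unfolding g_factor_def rm_eval_inf_def
    by (simp_all add: infinite_place.reg_add infinite_place.reg_mult infinite_place.reg_const
      infinite_place.ev_add infinite_place.ev_mult infinite_place.ev_const matrix_eq_iff)
qed

text \<open>With \<open>a = c / (l - z)\<close> and \<open>b = - c / (l - cnj z)\<close> for \<open>c = z - cnj z\<close>, idempotence of \<open>Q\<close> reduces the
  claim to \<open>a + b + b * a = 0\<close>.\<close>

lemma g_factor_unitary:
  assumes P: "hermitian_projection P" and l: "l \<noteq> z" "l \<noteq> cnj z"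
  shows "conj_transpose (rm_eval (g_factor z P) (cnj l)) ** rm_eval (g_factor z P) l = mat 1"
proof -
  define Q where "Q = mat 1 - P"
  have Q: "Q ** Q = Q" "conj_transpose Q = Q"
    using hermitian_projection_compl[OF P] by (auto simp: hermitian_projection_def Q_def)
  define a b where "a = (z - cnj z) / (l - z)" and "b = (cnj z - z) / (l - cnj z)"
  have "a + b + b * a = 0"
    using l by (simp add: a_def b_def divide_simps) (simp add: algebra_simps)
  then have "(mat 1 + b *\<^sub>m Q) ** (mat 1 + a *\<^sub>m Q) = mat 1"
    by (simp add: matrix_expand Q) (simp add: matrix_eq_iff, algebra)
  moreover have "cnj l \<noteq> z"
    using l by auto
  ultimately show ?thesis
    using l by (simp add: rm_eval_g_factor_residue Q_def[symmetric] Q a_def b_def)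
qed

section \<open>The reality conditions for the product\<close>

theorem theorem3p5:
  fixes z :: complex and \<pi> :: "complex ^ 'n::finite ^ 'n"
  assumes "z \<notin> \<real> \<union> (*) \<i> ` \<real>"
    and "hermitian_projection \<pi>"
  shows "f_factor z \<pi> \<in> Lambda_tau_sigma"
proof -
  have z: "Re z \<noteq> 0"
  proof
    assume "Re z = 0"
    then have "z = \<i> * complex_of_real (Im z)"
      by (simp add: complex_eq_iff)
    then have "z \<in> (*) \<i> ` \<real>"
      by (rule image_eqI) simp
    with assms(1) show False
      by blast
  qed
  have nz: "z + cnj z \<noteq> 0" "- cnj z \<noteq> z"
    using z by (auto simp: complex_eq_iff)
  define c k where "c = z - cnj z" and "k = (z - cnj z) / (z + cnj z)"
  define M where "M = mat 1 - k *\<^sub>m (mat 1 - \<pi>)"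
  define \<rho> where "\<rho> = hermitian_projection_onto (mat_image (M ** mat_cnj \<pi>))"
  note \<rho> = hermitian_projection_onto_range[of "M ** mat_cnj \<pi>", folded \<rho>_def]
  define R Q where "R = mat 1 - \<rho>" and "Q = mat 1 - \<pi>"
  have "(z - cnj z) / (- cnj z - z) = - k"
    using nz by (simp add: k_def divide_simps) (simp add: algebra_simps)
  then have "rm_eval (g_factor z \<pi>) (- cnj z) = M"
    using nz by (simp add: rm_eval_g_factor_residue M_def matrix_eq_iff)
  then have f: "f_factor z \<pi> = g_factor (- cnj z) \<rho> ** g_factor z \<pi>"
    by (simp add: f_factor_def Let_def \<rho>_def mat_image_def image_image matrix_vector_mul_assoc)
  let ?f = "f_factor z \<pi>"
  \<comment> \<open>The poles of the factors, closed up under \<open>cnj\<close> and negation.\<close>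
  let ?S = "{z, cnj z, - z, - cnj z}"
  have S_closed: "cnj l \<notin> ?S" "- l \<notin> ?S" if "l \<notin> ?S" for l
    using that by (auto simp: complex_eq_iff)
  have ev_f: "rm_eval ?f l = rm_eval (g_factor (- cnj z) \<rho>) l ** rm_eval (g_factor z \<pi>) l"
    and reg_f: "rm_regular ?f l" if "l \<notin> ?S" for l
    using that finite_place.ev_matrix_mult[of "g_factor (- cnj z) \<rho>" l "g_factor z \<pi>"]
      finite_place.reg_matrix_mult[of "g_factor (- cnj z) \<rho>" l "g_factor z \<pi>"]
      rm_regular_g_factor[of l z \<pi>] rm_regular_g_factor[of l "- cnj z" \<rho>]
    by (auto simp: f rm_eval_def rm_regular_def)

  have unitary: "conj_transpose (rm_eval ?f (cnj l)) ** rm_eval ?f l = mat 1" if "l \<notin> ?S" for l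
  proof -
    let ?A = "rm_eval (g_factor (- cnj z) \<rho>)" and ?B = "rm_eval (g_factor z \<pi>)"
    have "conj_transpose (rm_eval ?f (cnj l)) ** rm_eval ?f l
        = conj_transpose (?B (cnj l)) ** (conj_transpose (?A (cnj l)) ** ?A l) ** ?B l"
      unfolding ev_f[OF that] ev_f[OF S_closed(1)[OF that]] by (simp add: matrix_mul_assoc)
    then show ?thesis
      using that g_factor_unitary[OF \<rho>(1), of l "- cnj z"] g_factor_unitary[OF assms(2), of l z]
      by simp
  qed

  have res: "Q + k *\<^sub>m (R ** Q) = mat_cnj R + k *\<^sub>m (mat_cnj R ** mat_cnj Q)"
    using residues_agree[OF assms(2) \<rho>(1) z k_def Q_def R_def] \<rho>(2) by (simp add: M_def Q_def)
  then have "mat_cnj (Q + k *\<^sub>m (R ** Q)) = mat_cnj (mat_cnj R + k *\<^sub>m (mat_cnj R ** mat_cnj Q))"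
    by simp
  moreover have "cnj k = - k"
    using nz by (simp add: k_def field_simps)
  ultimately have res': "mat_cnj Q - k *\<^sub>m (mat_cnj R ** mat_cnj Q) = R - k *\<^sub>m (R ** Q)"
    by (simp add: matrix_eq_iff)

  \<comment> \<open>This is \<open>f = f'\<close>; \<open>res\<close> and \<open>res'\<close> compare the residues at \<open>z\<close> and at \<open>- cnj z\<close>.\<close>
  have real: "mat_cnj (rm_eval ?f (- cnj l)) = rm_eval ?f l" if "l \<notin> ?S" for l
  proof -
    define a b where "a = c / (l + cnj z)" and "b = c / (l - z)"
    have nzl: "l + cnj z \<noteq> 0" "l - z \<noteq> 0" "- l \<noteq> cnj z"
      using that by (auto simp: add_eq_0_iff minus_equation_iff[of l])
    \<comment> \<open>The partial fraction expansion of the product of the two poles.\<close>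
    have ab: "a * b = k * (b - a)"
      using nzl nz by (simp add: a_def b_def c_def k_def divide_simps) (simp add: algebra_simps)
    have fl: "rm_eval ?f l = (mat 1 + a *\<^sub>m R) ** (mat 1 + b *\<^sub>m Q)"
      using that by (simp add: ev_f rm_eval_g_factor_residue a_def b_def c_def R_def Q_def)
    have "cnj (c / (- cnj l + cnj z)) = b" "cnj (c / (- cnj l - z)) = a"
      using nzl by (simp_all add: a_def b_def c_def divide_simps) (simp_all add: algebra_simps)
    moreover have "- cnj l \<notin> ?S"
      using that by (auto simp: complex_eq_iff)
    ultimately have fl': "mat_cnj (rm_eval ?f (- cnj l))
        = (mat 1 + b *\<^sub>m mat_cnj R) ** (mat 1 + a *\<^sub>m mat_cnj Q)"
      by (simp add: ev_f rm_eval_g_factor_residue c_def R_def Q_def)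
    have "b * rb + a * (qb + b * w) = a * r + b * (q + a * v)"
      if "q + k * v = rb + k * w" "qb - k * w = r - k * v" for q r v qb rb w
    proof -
      have "b * rb + a * qb = a * r + b * q + k * (b - a) * (v - w)"
        using that by algebra
      then show ?thesis
        unfolding ab[symmetric] by (simp add: algebra_simps)
    qed
    moreover have "(Q + k *\<^sub>m (R ** Q)) $ i $ j = (mat_cnj R + k *\<^sub>m (mat_cnj R ** mat_cnj Q)) $ i $ j"
      "(mat_cnj Q - k *\<^sub>m (mat_cnj R ** mat_cnj Q)) $ i $ j = (R - k *\<^sub>m (R ** Q)) $ i $ j" for i j
      using res res' by simp_all
    ultimately show ?thesis
      unfolding fl fl' by (simp add: matrix_expand) (simp add: matrix_eq_iff)
  qed

  have transposed: "transpose (rm_eval ?f (- l)) ** rm_eval ?f l = mat 1" if "l \<notin> ?S" for l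
    using unitary[OF that] real[OF S_closed(2)[OF that]]
    by (metis complex_cnj_minus add.inverse_inverse conj_transpose_simps(8) mat_cnj_simps(7))

  have "det ?f \<noteq> 0"
  proof
    assume "det ?f = 0"
    obtain l where l: "l \<notin> ?S"
      using ex_new_if_finite[OF infinite_UNIV_char_0, of ?S] by auto
    have "det (rm_eval ?f l) = rf_eval (det ?f) l"
      using finite_place.ev_det[of ?f l] reg_f[OF l] by (simp add: rm_eval_def rm_regular_def)
    then have "det (rm_eval ?f l) = 0"
      using \<open>det ?f = 0\<close> finite_place.ev_0 by simp
    then show False
      using arg_cong[OF unitary[OF l], of det] by (simp add: det_mul)
  qed
  moreover have "rm_regular_inf ?f"
    unfolding f rm_regular_inf_def by (simp add: infinite_place.reg_matrix_mult g_factor_infinity)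
  moreover have "rm_eval_inf ?f = mat 1"
    unfolding f rm_eval_inf_def
    by (subst infinite_place.ev_matrix_mult)
      (simp_all add: g_factor_infinity(1) g_factor_infinity(2)[unfolded rm_eval_inf_def])
  moreover have "conj_transpose (rm_eval ?f (cnj l)) ** rm_eval ?f l = mat 1"
    if "rm_regular ?f l" "rm_regular ?f (cnj l)" for l
  proof (rule matrix_identity_extends[where S = ?S])
    fix i j
    show "isCont (\<lambda>l. rm_eval ?f l $ i $ j) l"
      using that by (intro isCont_rm_eval)
    show "isCont (\<lambda>l. conj_transpose (rm_eval ?f (cnj l)) $ i $ j) l"
      using isCont_o2[of l cnj, OF _ isCont_rm_eval[OF that(2)]]
      by (simp add: conj_transpose_def transpose_def)
  qed (use unitary in auto)
  moreover have "transpose (rm_eval ?f (- l)) ** rm_eval ?f l = mat 1"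
    if "rm_regular ?f l" "rm_regular ?f (- l)" for l
  proof (rule matrix_identity_extends[where S = ?S])
    fix i j
    show "isCont (\<lambda>l. rm_eval ?f l $ i $ j) l"
      using that by (intro isCont_rm_eval)
    show "isCont (\<lambda>l. transpose (rm_eval ?f (- l)) $ i $ j) l"
      using isCont_o2[of l uminus, OF _ isCont_rm_eval[OF that(2)]]
      by (simp add: transpose_def)
  qed (use transposed in auto)
  ultimately show ?thesis
    unfolding Lambda_tau_sigma_def by blast
qed

end
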